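(* Let $j$ be a positive integer and let $X$ be the metric completion of the metric space $(V,d)$ (constructed from $j$ as in the context). Then whenever $Y$ is a complete metric space with a conical midpoint map $m_Y$ and $A\subset Y$ contains at most $j$ points, there exists a Lipschitz map $\Phi\colon X\to Y$ such that $A\subset\Phi(X)$ and, furthermore, $\Phi(X)$ is $\sigma_Y$-convex with respect to the conical bicombing $\sigma_Y$ on $Y$ induced by $m_Y$.
   Context: Construction of $(V,d)$. Fix a positive integer $j$ and let $V_0=\{0,\ldots,j-1\}$, whose elements are regarded as $j$ distinct atoms (ur-elements, not sets). Let $d_0$ be the discrete metric on $V_0$ ($d_0(x,y)=1$ if $x\ne y$, and $0$ otherwise). For any $a,b$ put $m(a,b)=\{a,b\}$ if $a\neq b$ and $m(a,b)=a$ if $a=b$. For $n>0$ define recursively $V_n=\{m(a,b):a,b\in V_{n-1}\}$. Then $V_0\subset V_1\subset V_2\subset\cdots$; let $V=\bigcup_{n\ge0}V_n$. Every $x\in V\setminus V_0$ can be written as $x=m(a,b)$ with distinct $a,b\in V$, unique up to order, called the parents of $x$. The function $d\colon V\times V\to\mathbb{R}$ is defined recursively by: (1) if $x,y\in V_0$, then $d(x,y)=d_0(x,y)$; (2) if $x\in V_0$ and $y\in V\setminus V_0$ has parents $c,e$, then $d(x,y)=d(y,x)=\frac12\big(d(x,c)+d(x,e)\big)$; (3) if $x,y\in V\setminus V_0$ have parents $a,b$ and $c,e$, respectively, then $d(x,y)=\frac12\min\{d(x,c)+d(x,e),\ d(y,a)+d(y,b),\ d(a,c)+d(b,e),\ d(a,e)+d(b,c)\}$.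 This $d$ is a well-defined metric on $V$. Conical midpoint maps and induced bicombings. A conical midpoint map on a metric space $(Y,d)$ is a map $m_Y\colon Y\times Y\to Y$ such that for all $x,y,z\in Y$: $m_Y(x,x)=x$; $m_Y(x,y)=m_Y(y,x)$; $d(m_Y(x,y),m_Y(x,z))\le\frac12 d(y,z)$. A geodesic is a map $c\colon[0,1]\to Y$ with $d(c(s),c(t))=|s-t|\,d(c(0),c(1))$ for all $s,t\in[0,1]$. A (geodesic) bicombing on $Y$ is a map $\sigma\colon Y\times Y\times[0,1]\to Y$ such that each $\sigma_{xy}=\sigma(x,y,\cdot)$ is a geodesic from $x$ to $y$; it is conical if $d(\sigma_{xy}(t),\sigma_{x'y'}(t))\le(1-t)\,d(x,x')+t\,d(y,y')$ for all $x,y,x',y'\in Y$, $t\in[0,1]$. If $Y$ is complete, the bicombing $\sigma_Y$ induced by $m_Y$ is defined as follows. Let $\mathcal{G}_n=(2^{-n}\mathbb{Z})\cap[0,1]$ for $n\ge0$. For $x,y\in Y$ set $\sigma_{xy}(0)=x$, $\sigma_{xy}(1)=y$, and for $n\ge1$ and $t\in\mathcal{G}_n\setminus\mathcal{G}_{n-1}$ set $\sigma_{xy}(t)=m_Y(\sigma_{xy}(r),\sigma_{xy}(s))$, where $r,s\in\mathcal{G}_{n-1}$ are the unique points (up to order) with $t=\frac12r+\frac12s$ and $|r-s|=2^{-(n-1)}$. This map on $\bigcup_n\mathcal{G}_n$ extends uniquely to a geodesic $[0,1]\to Y$, and these geodesics form the conical bicombing $\sigma_Y$. A subset $C\subset Y$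 is $\sigma_Y$-convex if $\sigma_Y(x,y,t)\in C$ for all $x,y\in C$, $t\in[0,1]$. *)

theory Defs
  imports "HOL-Analysis.Analysis" "HOL-Library.FSet"
begin

section \<open>The sets \<open>V\<^sub>n\<close> and \<open>V\<close>\<close>

text \<open>Hereditarily finite sets over atoms (ur-elements) labelled by natural numbers.\<close>

datatype hset = Atom nat | HSet "hset fset"

definition mid :: "hset \<Rightarrow> hset \<Rightarrow> hset" where
  "mid a b = (if a = b then a else HSet {|a, b|})"

primrec Vn :: "nat \<Rightarrow> nat \<Rightarrow> hset set" where
  "Vn j 0 = Atom ` {..<j}"
| "Vn j (Suc n) = {mid a b |a b. a \<in> Vn j n \<and> b \<in> Vn j n}"

definition Vset :: "nat \<Rightarrow> hset set" where
  "Vset j = (\<Union>n. Vn j n)"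

definition are_parents :: "hset \<Rightarrow> hset \<times> hset \<Rightarrow> bool" where
  "are_parents x p \<longleftrightarrow> fst p \<noteq> snd p \<and> x = mid (fst p) (snd p)"

text \<open>
  The two parents in an arbitrary order. Terms without parents receive a dummy value, which is
  never used in computing \<open>dV\<close> on \<open>Vset j\<close>.
\<close>

definition parents :: "hset \<Rightarrow> hset \<times> hset" where
  "parents x = (if \<exists>p. are_parents x p then (SOME p. are_parents x p) else (Atom 0, Atom 0))"

lemma size_fmember: "x |\<in>| S \<Longrightarrow> size x < size (HSet S)"
proof -
  assume "x |\<in>| S"
  then have "Suc (size x) \<le> (\<Sum>y\<in>fset S. Suc (size y))"
    by (intro member_le_sum[of x "fset S" "\<lambda>y. Suc (size y)"]) auto
  then show ?thesis by simp
qed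

lemma doubleton_fset_eq_iff:
  "{|a, b|} = {|c, e|} \<longleftrightarrow> a = c \<and> b = e \<or> a = e \<and> b = c"
  unfolding fset_inject[symmetric] by (simp add: doubleton_eq_iff)

lemma parents_cases: "are_parents x (parents x) \<or> parents x = (Atom 0, Atom 0)"
  unfolding parents_def using someI_ex[of "are_parents x"] by simp

lemma size_parents:
  assumes "(a, b) = parents (HSet S)"
  shows "size a < size (HSet S) \<and> size b < size (HSet S)"
  using parents_cases[of "HSet S"]
proof
  assume "are_parents (HSet S) (parents (HSet S))"
  then have "S = {|a, b|}"
    by (auto simp: assms[symmetric] are_parents_def mid_def split: if_splits)
  then show ?thesis by (auto intro!: size_fmember simp del: hset.size)
qed (use assms in simp)

lemma parents_HSet:
  assumes "a \<noteq> b"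
  shows "parents (HSet {|a, b|}) = (a, b) \<or> parents (HSet {|a, b|}) = (b, a)"
proof -
  have "are_parents (HSet {|a, b|}) (a, b)"
    using assms by (simp add: are_parents_def mid_def)
  then have "are_parents (HSet {|a, b|}) (parents (HSet {|a, b|}))"
    using parents_cases someI_ex[of "are_parents (HSet {|a, b|})"] unfolding parents_def by auto
  then show ?thesis
    by (cases "parents (HSet {|a, b|})") (auto simp: are_parents_def mid_def doubleton_fset_eq_iff)
qed

section \<open>The metric on \<open>V\<close>\<close>

text \<open>
  The right-hand sides are invariant under exchanging the two parents, so the arbitrary order
  chosen by \<open>parents\<close> does not matter; see \<open>dV_Atom_pair\<close> and \<open>dV_pair_pair\<close>.
\<close>

function dV :: "hset \<Rightarrow> hset \<Rightarrow> real" where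
  "dV (Atom i) (Atom k) = (if i = k then 0 else 1)"
| "dV (Atom i) (HSet T) =
    (let (c, e) = parents (HSet T) in (dV (Atom i) c + dV (Atom i) e) / 2)"
| "dV (HSet S) (Atom k) =
    (let (a, b) = parents (HSet S) in (dV (Atom k) a + dV (Atom k) b) / 2)"
| "dV (HSet S) (HSet T) =
    (let (a, b) = parents (HSet S); (c, e) = parents (HSet T) in
      Min {dV (HSet S) c + dV (HSet S) e, dV (HSet T) a + dV (HSet T) b,
           dV a c + dV b e, dV a e + dV b c} / 2)"
  by pat_completeness auto
termination
proof (relation "Wellfounded.measure (\<lambda>(x, y). size x + size y)", goal_cases)
  case 1
  then show ?case by simp
qed (auto dest!: size_parents simp del: hset.size(4))

declare dV.simps [simp del] hset.size(4) [simp del]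

lemma dV_Atom_pair:
  assumes "c \<noteq> e"
  shows "dV (Atom i) (HSet {|c, e|}) = (dV (Atom i) c + dV (Atom i) e) / 2"
    and "dV (HSet {|c, e|}) (Atom i) = (dV (Atom i) c + dV (Atom i) e) / 2"
  using parents_HSet[OF assms] by (auto simp: dV.simps)

lemma dV_pair_pair:
  assumes "a \<noteq> b" "c \<noteq> e" "x = HSet {|a, b|}" "y = HSet {|c, e|}"
  shows "dV x y =
    Min {dV x c + dV x e, dV y a + dV y b, dV a c + dV b e, dV a e + dV b c} / 2"
  using parents_HSet[OF assms(1)] parents_HSet[OF assms(2)] unfolding assms(3,4)
  by (elim disjE; simp add: dV.simps insert_commute add.commute del: Min_insert)

lemma dV_nonneg: "0 \<le> dV x y"
  by (induction x y rule: dV.induct) (auto simp: dV.simps split: prod.splits)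

lemma dV_commute: "dV x y = dV y x"
proof (induction x y rule: dV.induct)
  case (4 S T)
  obtain a b where ab: "parents (HSet S) = (a, b)" by fastforce
  obtain c e where ce: "parents (HSet T) = (c, e)" by fastforce
  have "dV a c = dV c a" "dV b e = dV e b" "dV a e = dV e a" "dV b c = dV c b"
    using 4 ab ce by (metis)+
  then show ?case
    by (simp add: dV.simps ab ce insert_commute add.commute del: Min_insert)
qed (auto simp: dV.simps split: prod.splits)

lemma Vset_cases:
  assumes "x \<in> Vset j"
  obtains (atom) i where "i < j" "x = Atom i"
  | (pair) a b where "a \<in> Vset j" "b \<in> Vset j" "a \<noteq> b" "x = HSet {|a, b|}"
proof -
  have "(\<exists>i<j. x = Atom i) \<or> (\<exists>a\<in>Vset j. \<exists>b\<in>Vset j. a \<noteq> b \<and> x = HSet {|a, b|})"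
    if "x \<in> Vn j n" for n
    using that
  proof (induction n arbitrary: x)
    case (Suc n)
    then obtain a b where ab: "a \<in> Vn j n" "b \<in> Vn j n" "x = mid a b" by auto
    show ?case
    proof (cases "a = b")
      case True
      then show ?thesis using ab Suc.IH by (simp add: mid_def)
    next
      case False
      have "a \<in> Vset j" "b \<in> Vset j" using ab by (auto simp: Vset_def)
      with False ab show ?thesis by (auto simp: mid_def)
    qed
  qed auto
  with assms that show thesis unfolding Vset_def by blast
qed

lemma dV_split_le:
  assumes "x \<in> Vset j" "c \<noteq> e"
  shows "dV x (HSet {|c, e|}) \<le> (dV x c + dV x e) / 2"
  using assms(1)
proof (cases rule: Vset_cases)
  case (atom i)
  then show ?thesis using dV_Atom_pair(1)[OF assms(2)] by simp
next
  case (pair a b)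
  then show ?thesis using dV_pair_pair[OF pair(3) assms(2) pair(4) refl] by simp
qed

lemma dV_match_le:
  assumes "a \<noteq> b" "c \<noteq> e"
  shows "dV (HSet {|a, b|}) (HSet {|c, e|}) \<le> (dV a c + dV b e) / 2"
  using dV_pair_pair[OF assms refl refl] by simp

lemma dV_forms:
  assumes "x \<in> Vset j" "y \<in> Vset j"
  obtains (atoms) i k where "x = Atom i" "y = Atom k"
  | (right) c e where "c \<in> Vset j" "e \<in> Vset j" "c \<noteq> e" "y = HSet {|c, e|}"
      "dV x y = (dV x c + dV x e) / 2"
  | (left) a b where "a \<in> Vset j" "b \<in> Vset j" "a \<noteq> b" "x = HSet {|a, b|}"
      "dV x y = (dV a y + dV b y) / 2"
  | (match) a b c e where "a \<in> Vset j" "b \<in> Vset j" "a \<noteq> b" "x = HSet {|a, b|}"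
      "c \<in> Vset j" "e \<in> Vset j" "c \<noteq> e" "y = HSet {|c, e|}"
      "dV x y = (dV a c + dV b e) / 2"
  using assms(1)
proof (cases rule: Vset_cases)
  case x: (atom i)
  from assms(2) show ?thesis
  proof (cases rule: Vset_cases)
    case (atom k)
    then show ?thesis using x atoms by blast
  next
    case (pair c e)
    then show ?thesis using x right dV_Atom_pair(1)[OF pair(3)] by blast
  qed
next
  case x: (pair a b)
  from assms(2) show ?thesis
  proof (cases rule: Vset_cases)
    case (atom k)
    then show ?thesis using x left dV_Atom_pair(2)[OF x(3)] by (metis dV_commute)
  next
    case y: (pair c e)
    let ?D = "{dV x c + dV x e, dV y a + dV y b, dV a c + dV b e, dV a e + dV b c}"
    have eq: "dV x y = Min ?D / 2" using dV_pair_pair[OF x(3) y(3) x(4) y(4)] .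
    have "Min ?D \<in> ?D" by (rule Min_in) auto
    then consider "dV x y = (dV x c + dV x e) / 2" | "dV x y = (dV a y + dV b y) / 2"
      | "dV x y = (dV a c + dV b e) / 2" | "dV x y = (dV a e + dV b c) / 2"
      unfolding eq by (auto simp: dV_commute[of y] simp del: Min_insert)
    then show ?thesis
    proof cases
      case 1 then show ?thesis using right y by blast
    next
      case 2 then show ?thesis using left x by blast
    next
      case 3 then show ?thesis using match x y by blast
    next
      case 4
      have "y = HSet {|e, c|}" using y(4) by (simp add: doubleton_fset_eq_iff)
      then show ?thesis using match[of a b e c] x y 4 by blast
    qed
  qed
qed

lemma dV_triangle:
  assumes "x \<in> Vset j" "y \<in> Vset j" "z \<in> Vset j"
  shows "dV x z \<le> dV x y + dV y z"
  using assms
proof (induction "size x + size y + size z" arbitrary: x y z rule: less_induct)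
  case less
  have sz: "size a < size (HSet {|a, b|}) \<and> size b < size (HSet {|a, b|})" for a b
    by (simp add: size_fmember)
  have le_right: "dV u (HSet {|c, e|}) \<le> (dV u c + dV u e) / 2"
    if "u \<in> Vset j" "c \<noteq> e" for u c e using dV_split_le[OF that] .
  have le_left: "dV (HSet {|c, e|}) u \<le> (dV c u + dV e u) / 2"
    if "u \<in> Vset j" "c \<noteq> e" for u c e using dV_split_le[OF that] by (simp add: dV_commute)
  note IH = less.hyps
  note xyz = less.prems
  show ?case using xyz(1,2)
  proof (cases rule: dV_forms)
    case xy: (left a b)
    have "dV a z \<le> dV a y + dV y z" "dV b z \<le> dV b y + dV y z"
      using IH[of a y z] IH[of b y z] xy xyz sz[of a b] by auto
    then show ?thesis using le_left[OF xyz(3) xy(3)] xy by auto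
  next
    case xy: (atoms i k)
    show ?thesis using xyz(2,3)
    proof (cases rule: dV_forms)
      case yz: (right g h)
      have "dV x g \<le> dV x y + dV y g" "dV x h \<le> dV x y + dV y h"
        using IH[of x y g] IH[of x y h] yz xyz sz[of g h] by auto
      then show ?thesis using le_right[OF xyz(1) yz(3)] yz by auto
    qed (use xy in \<open>auto simp: dV.simps\<close>)
  next
    case xy: (right c e)
    show ?thesis using xyz(2,3)
    proof (cases rule: dV_forms)
      case yz: (right g h)
      have "dV x g \<le> dV x y + dV y g" "dV x h \<le> dV x y + dV y h"
        using IH[of x y g] IH[of x y h] yz xyz sz[of g h] by auto
      then show ?thesis using le_right[OF xyz(1) yz(3)] yz by auto
    next
      case yz: (left c' e')
      have "dV x z \<le> dV x c + dV c z" "dV x z \<le> dV x e + dV e z"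
        using IH[of x c z] IH[of x e z] xy xyz sz[of c e] by auto
      moreover have "c = c' \<and> e = e' \<or> c = e' \<and> e = c'"
        using xy yz by (auto simp: doubleton_fset_eq_iff)
      ultimately show ?thesis using xy yz by auto
    next
      case yz: (match c' e' g h)
      have "c = c' \<and> e = e' \<or> c = e' \<and> e = c'"
        using xy yz by (auto simp: doubleton_fset_eq_iff)
      then have xy': "dV x y = (dV x c' + dV x e') / 2" using xy by auto
      have "dV x g \<le> dV x c' + dV c' g" "dV x h \<le> dV x e' + dV e' h"
        using IH[of x c' g] IH[of x e' h] yz xyz sz[of c' e'] sz[of g h] by auto
      then show ?thesis using le_right[OF xyz(1) yz(7)] xy' yz by auto
    qed (use xy in auto)
  next
    case xy: (match a b c e)
    show ?thesis using xyz(2,3)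
    proof (cases rule: dV_forms)
      case yz: (right g h)
      have "dV x g \<le> dV x y + dV y g" "dV x h \<le> dV x y + dV y h"
        using IH[of x y g] IH[of x y h] yz xyz sz[of g h] by auto
      then show ?thesis using le_right[OF xyz(1) yz(3)] yz by auto
    next
      case yz: (left c' e')
      have "c = c' \<and> e = e' \<or> c = e' \<and> e = c'"
        using xy yz by (auto simp: doubleton_fset_eq_iff)
      then have yz': "dV y z = (dV c z + dV e z) / 2" using yz by auto
      have "dV a z \<le> dV a c + dV c z" "dV b z \<le> dV b e + dV e z"
        using IH[of a c z] IH[of b e z] xy xyz sz[of a b] sz[of c e] by auto
      then show ?thesis using le_left[OF xyz(3) xy(3)] xy yz' by auto
    next
      case yz: (match c' e' g h)
      obtain g' h' where z: "g' \<in> Vset j" "h' \<in> Vset j" "g' \<noteq> h'" "z = HSet {|g', h'|}"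
        and yz': "dV y z = (dV c g' + dV e h') / 2"
      proof (cases "c = c'")
        case True
        then have "e = e'" using xy yz by (auto simp: doubleton_fset_eq_iff)
        then show thesis using that yz True by blast
      next
        case False
        then have "c = e'" "e = c'" using xy yz by (auto simp: doubleton_fset_eq_iff)
        moreover have "z = HSet {|h, g|}" using yz(8) by (simp add: doubleton_fset_eq_iff)
        ultimately show thesis using that[of h g] yz by (simp add: add.commute)
      qed
      have "dV a g' \<le> dV a c + dV c g'" "dV b h' \<le> dV b e + dV e h'"
        using IH[of a c g'] IH[of b e h'] xy xyz z sz[of a b] sz[of c e] sz[of g' h'] by auto
      then show ?thesis using dV_match_le[OF xy(3) z(3)] xy z yz' by auto
    qed (use xy in auto)
  qed
qed

lemma dV_zero_iff:
  assumes "x \<in> Vset j" "y \<in> Vset j"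
  shows "dV x y = 0 \<longleftrightarrow> x = y"
proof
  have sz: "size a < size (HSet {|a, b|}) \<and> size b < size (HSet {|a, b|})" for a b
    by (simp add: size_fmember)
  show "x = y" if "dV x y = 0" using assms that
  proof (induction "size x + size y" arbitrary: x y rule: less_induct)
    case less
    note IH = less.hyps
    show ?case using less.prems(1,2)
    proof (cases rule: dV_forms)
      case (atoms i k)
      then show ?thesis using less.prems(3) by (auto simp: dV.simps split: if_splits)
    next
      case (right c e)
      then have "dV x c = 0" "dV x e = 0"
        using dV_nonneg[of x c] dV_nonneg[of x e] less.prems(3) by auto
      then have "x = c" "x = e"
        using IH[of x c] IH[of x e] right less.prems sz[of c e] by auto
      then show ?thesis using right by simp
    next
      case (left a b)
      then have "dV a y = 0" "dV b y = 0"
        using dV_nonneg[of a y] dV_nonneg[of b y] less.prems(3) by auto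
      then have "a = y" "b = y"
        using IH[of a y] IH[of b y] left less.prems sz[of a b] by auto
      then show ?thesis using left by simp
    next
      case (match a b c e)
      then have "dV a c = 0" "dV b e = 0"
        using dV_nonneg[of a c] dV_nonneg[of b e] less.prems(3) by auto
      then have "a = c" "b = e"
        using IH[of a c] IH[of b e] match less.prems sz[of a b] sz[of c e] by auto
      then show ?thesis using match by simp
    qed
  qed
next
  have "dV x x = 0" if "x \<in> Vset j" for x
    using that
  proof (induction "size x" arbitrary: x rule: less_induct)
    case less
    show ?case using less.prems
    proof (cases rule: Vset_cases)
      case (pair a b)
      have "size a < size x" "size b < size x"
        unfolding pair(4) by (rule size_fmember, simp)+
      then have "dV a a = 0" "dV b b = 0" using less.hyps pair by auto
      then show ?thesis
        using dV_match_le[OF pair(3) pair(3)] dV_nonneg[of x x] pair(4) by simp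
    qed (simp add: dV.simps)
  qed
  then show "dV x y = 0" if "x = y" using that assms by simp
qed

lemma Metric_space_V: "Metric_space (Vset j) dV"
proof
  show "0 \<le> dV x y" for x y by (rule dV_nonneg)
  show "dV x y = dV y x" for x y by (rule dV_commute)
qed (simp_all add: dV_zero_iff dV_triangle)

definition V_metric :: "nat \<Rightarrow> hset metric" where
  "V_metric j = metric (Vset j, dV)"

lemma mspace_V_metric [simp]: "mspace (V_metric j) = Vset j"
  and mdist_V_metric [simp]: "mdist (V_metric j) = dV"
  unfolding V_metric_def
  by (rule Metric_space.mspace_metric[OF Metric_space_V] Metric_space.mdist_metric[OF Metric_space_V])+

section \<open>Metric completions\<close>

definition is_metric_completion :: "'a metric \<Rightarrow> 'b metric \<Rightarrow> ('a \<Rightarrow> 'b) \<Rightarrow> bool" where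
  "is_metric_completion M X \<iota> \<longleftrightarrow>
     mcomplete_of X \<and>
     \<iota> \<in> mspace M \<rightarrow> mspace X \<and>
     (\<forall>x\<in>mspace M. \<forall>y\<in>mspace M. mdist X (\<iota> x) (\<iota> y) = mdist M x y) \<and>
     mtopology_of X closure_of (\<iota> ` mspace M) = mspace X"

lemma is_metric_completion_exists:
  "\<exists>(X :: ('a \<Rightarrow> real) metric) \<iota>. is_metric_completion (M :: 'a metric) X \<iota>"
proof -
  obtain \<iota> :: "'a \<Rightarrow> 'a \<Rightarrow> real" and X where
    "mcomplete_of X" "\<iota> \<in> mspace M \<rightarrow> mspace X"
    "mtopology_of X closure_of \<iota> ` mspace M = mspace X"
    "\<And>x y. x \<in> mspace M \<Longrightarrow> y \<in> mspace M \<Longrightarrow> mdist X (\<iota> x) (\<iota> y) = mdist M x y"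
    using Metric_space.metric_completion[OF Metric_space_mspace_mdist[of M]] by metis
  then show ?thesis unfolding is_metric_completion_def by blast
qed

section \<open>Conical midpoint maps and induced bicombings\<close>

definition conical_midpoint_map :: "'a metric \<Rightarrow> ('a \<Rightarrow> 'a \<Rightarrow> 'a) \<Rightarrow> bool" where
  "conical_midpoint_map Y m \<longleftrightarrow>
     (\<forall>x\<in>mspace Y. \<forall>y\<in>mspace Y. m x y \<in> mspace Y) \<and>
     (\<forall>x\<in>mspace Y. m x x = x) \<and>
     (\<forall>x\<in>mspace Y. \<forall>y\<in>mspace Y. m x y = m y x) \<and>
     (\<forall>x\<in>mspace Y. \<forall>y\<in>mspace Y. \<forall>z\<in>mspace Y.
        mdist Y (m x y) (m x z) \<le> 1/2 * mdist Y y z)"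

definition geodesic :: "'a metric \<Rightarrow> (real \<Rightarrow> 'a) \<Rightarrow> bool" where
  "geodesic Y c \<longleftrightarrow>
     c \<in> {0..1} \<rightarrow> mspace Y \<and>
     (\<forall>s\<in>{0..1}. \<forall>t\<in>{0..1}. mdist Y (c s) (c t) = \<bar>s - t\<bar> * mdist Y (c 0) (c 1))"

definition dyadic_grid :: "nat \<Rightarrow> real set" where
  "dyadic_grid n = range (\<lambda>k::int. of_int k / 2 ^ n) \<inter> {0..1}"

definition dyadic_midpoint_rule :: "('a \<Rightarrow> 'a \<Rightarrow> 'a) \<Rightarrow> (real \<Rightarrow> 'a) \<Rightarrow> bool" where
  "dyadic_midpoint_rule m c \<longleftrightarrow>
     (\<forall>n\<ge>1. \<forall>t \<in> dyadic_grid n - dyadic_grid (n - 1).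
        \<forall>r \<in> dyadic_grid (n - 1). \<forall>s \<in> dyadic_grid (n - 1).
          t = r / 2 + s / 2 \<and> \<bar>r - s\<bar> = 1 / 2 ^ (n - 1) \<longrightarrow> c t = m (c r) (c s))"

text \<open>
  \<open>induced_bicombing Y m x y\<close> is the unique geodesic extending the values that the midpoint
  recursion prescribes on the dyadic numbers. The choice operator is used because
  uniqueness only concerns the values on \<open>{0..1}\<close>; the other values are irrelevant.
\<close>

definition induced_bicombing :: "'a metric \<Rightarrow> ('a \<Rightarrow> 'a \<Rightarrow> 'a) \<Rightarrow> 'a \<Rightarrow> 'a \<Rightarrow> real \<Rightarrow> 'a" where
  "induced_bicombing Y m x y =
     (SOME c. geodesic Y c \<and> c 0 = x \<and> c 1 = y \<and> dyadic_midpoint_rule m c)"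

definition bicombing_convex ::
    "'a metric \<Rightarrow> ('a \<Rightarrow> 'a \<Rightarrow> real \<Rightarrow> 'a) \<Rightarrow> 'a set \<Rightarrow> bool" where
  "bicombing_convex Y \<sigma> C \<longleftrightarrow>
     C \<subseteq> mspace Y \<and> (\<forall>x\<in>C. \<forall>y\<in>C. \<forall>t\<in>{0..1}. \<sigma> x y t \<in> C)"

end

theory Submission
  imports Defs
begin

text \<open>
  Evaluate every element of \<open>V\<close> in \<open>Y\<close>: send the \<open>j\<close> atoms to points covering \<open>A\<close> and replace each
  formation of a midpoint by \<open>m\<^sub>Y\<close>. By the recursive formula for \<open>d\<close> this map is Lipschitz, with any
  bound for the distances between the images of the atoms as constant, so it extends to \<open>\<Phi>\<close> on \<open>X\<close>. The map
  \<open>(a, b) \<mapsto> m(a, b)\<close> on \<open>V\<close> also extends to a conical midpoint map \<open>m\<^sub>X\<close> on \<open>X\<close>, and \<open>\<Phi>\<close> intertwines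
  \<open>m\<^sub>X\<close> with \<open>m\<^sub>Y\<close>. Hence \<open>\<Phi>\<close> maps the geodesics induced by \<open>m\<^sub>X\<close> onto those induced by \<open>m\<^sub>Y\<close>,
  because the two agree at dyadic parameters.
\<close>

section \<open>Extension to complete metric spaces\<close>

lemma mdist_self [simp]: "x \<in> mspace M \<Longrightarrow> mdist M x x = 0"
  by (simp add: mdist_zero)

text \<open>Apply the hypothesis to \<open>e / (\<bar>C\<bar> + 1)\<close>. The denominator spares
  any assumption on \<open>C\<close>, which later is often a multiple of a Lipschitz constant or a
  distance that may vanish.\<close>

lemma le_if_le_add_mult:
  fixes a b C :: real
  assumes "\<And>e. e > 0 \<Longrightarrow> a \<le> b + C * e"
  shows "a \<le> b"
proof (rule field_le_epsilon)
  fix e :: real assume e: "e > 0"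
  have "C * (e / (\<bar>C\<bar> + 1)) \<le> \<bar>C\<bar> * (e / (\<bar>C\<bar> + 1))"
    using e by (intro mult_right_mono) auto
  also have "\<dots> \<le> e" using e by (simp add: field_simps)
  finally have "C * (e / (\<bar>C\<bar> + 1)) \<le> e" .
  moreover have "e / (\<bar>C\<bar> + 1) > 0" using e by simp
  then have "a \<le> b + C * (e / (\<bar>C\<bar> + 1))" by (rule assms)
  ultimately show "a \<le> b + e" by linarith
qed

text \<open>\<open>D u x\<close> measures how far the node \<open>u\<close> is from \<open>x\<close>; nodes and points may have different types.\<close>

lemma complete_extension:
  fixes D :: "'u \<Rightarrow> 'x \<Rightarrow> real"
  assumes "mcomplete_of Y"
    and f: "\<And>u. u \<in> S \<Longrightarrow> f u \<in> mspace Y"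
    and dense: "\<And>x e. x \<in> T \<Longrightarrow> e > 0 \<Longrightarrow> \<exists>u\<in>S. D u x < e"
    and le: "\<And>u v x. u \<in> S \<Longrightarrow> v \<in> S \<Longrightarrow> x \<in> T \<Longrightarrow> mdist Y (f u) (f v) \<le> D u x + D v x"
  obtains F where "\<And>x. x \<in> T \<Longrightarrow> F x \<in> mspace Y"
    and "\<And>u x. u \<in> S \<Longrightarrow> x \<in> T \<Longrightarrow> mdist Y (f u) (F x) \<le> D u x"
proof -
  interpret Y: Metric_space "mspace Y" "mdist Y" by simp
  have "\<exists>y\<in>mspace Y. \<forall>u\<in>S. mdist Y (f u) y \<le> D u x" if x: "x \<in> T" for x
  proof -
    \<comment> \<open>The value at \<open>x\<close> is the limit of \<open>f\<close> along nodes
      \<open>w n\<close> that approach \<open>x\<close>; by \<open>le\<close> these values form a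
      Cauchy sequence.\<close>
    have "\<forall>n. \<exists>u\<in>S. D u x < 1 / real (Suc n)" using dense[OF x] by simp
    then obtain w where w: "\<And>n. w n \<in> S" "\<And>n. D (w n) x < 1 / real (Suc n)" by metis
    have small: "D (w n) x < e" if "1 / real (Suc N) < e" "N \<le> n" for e n N
    proof -
      have "1 / real (Suc n) \<le> 1 / real (Suc N)" using that(2) by (simp add: field_simps)
      then show ?thesis using w(2)[of n] that(1) by linarith
    qed
    have "Y.MCauchy (\<lambda>n. f (w n))"
      unfolding Y.MCauchy_def
    proof (intro conjI allI impI)
      show "range (\<lambda>n. f (w n)) \<subseteq> mspace Y" using f w by auto
      fix e :: real assume "e > 0"
      then obtain N where N: "1 / real (Suc N) < e / 2"
        by (metis half_gt_zero nat_approx_posE)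
      have "mdist Y (f (w n)) (f (w n')) < e" if "N \<le> n" "N \<le> n'" for n n'
        using le[OF w(1) w(1) x, of n n'] small[OF N that(1)] small[OF N that(2)] by linarith
      then show "\<exists>N. \<forall>n n'. N \<le> n \<longrightarrow> N \<le> n' \<longrightarrow> mdist Y (f (w n)) (f (w n')) < e" by blast
    qed
    then obtain y where "limitin Y.mtopology (\<lambda>n. f (w n)) y sequentially"
      using assms(1) unfolding mcomplete_of_def Y.mcomplete_def by blast
    then have y: "y \<in> mspace Y" "\<And>e. e > 0 \<Longrightarrow> \<exists>N. \<forall>n\<ge>N. mdist Y (f (w n)) y < e"
      unfolding Y.limit_metric_sequentially by blast+
    \<comment> \<open>Pass to the limit in \<open>le\<close> for \<open>u\<close> and
      \<open>w n\<close>. One \<open>e\<close> pays for \<open>D (w n) x\<close>, the other for the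
      distance from \<open>f (w n)\<close> to \<open>y\<close>.\<close>
    have "mdist Y (f u) y \<le> D u x" if u: "u \<in> S" for u
    proof (rule le_if_le_add_mult[where C = 2])
      fix e :: real assume e: "e > 0"
      obtain N where N: "1 / real (Suc N) < e" using e by (metis nat_approx_posE)
      obtain N' where N': "\<And>n. n \<ge> N' \<Longrightarrow> mdist Y (f (w n)) y < e" using y(2)[OF e] by blast
      let ?n = "max N N'"
      have "mdist Y (f u) y \<le> mdist Y (f u) (f (w ?n)) + mdist Y (f (w ?n)) y"
        using f u w(1) y(1) by (intro mdist_triangle) auto
      then show "mdist Y (f u) y \<le> D u x + 2 * e"
        using le[OF u w(1) x, of ?n] small[OF N, of ?n] N'[of ?n] by simp
    qed
    with y(1) show ?thesis by blast
  qed
  then show thesis using that by metis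
qed

section \<open>The bicombing induced by a conical midpoint map\<close>

lemma conical_midpoint_mapD:
  assumes "conical_midpoint_map Y m"
  shows "x \<in> mspace Y \<Longrightarrow> y \<in> mspace Y \<Longrightarrow> m x y \<in> mspace Y"
    and "x \<in> mspace Y \<Longrightarrow> m x x = x"
    and "x \<in> mspace Y \<Longrightarrow> y \<in> mspace Y \<Longrightarrow> m x y = m y x"
    and "x \<in> mspace Y \<Longrightarrow> y \<in> mspace Y \<Longrightarrow> z \<in> mspace Y \<Longrightarrow>
      mdist Y (m x y) (m x z) \<le> mdist Y y z / 2"
  using assms unfolding conical_midpoint_map_def by auto

text \<open>Change one argument at a time, going through \<open>m a e\<close>; symmetry turns a
  change of the first argument into one of the second.\<close>

lemma conical_midpoint_map_dist_le:
  assumes m: "conical_midpoint_map Y m"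
    and "a \<in> mspace Y" "b \<in> mspace Y" "c \<in> mspace Y" "e \<in> mspace Y"
  shows "mdist Y (m a b) (m c e) \<le> (mdist Y a c + mdist Y b e) / 2"
proof -
  note mD = conical_midpoint_mapD[OF m]
  have "mdist Y (m a b) (m c e) \<le> mdist Y (m a b) (m a e) + mdist Y (m e a) (m e c)"
    using mdist_triangle[of "m a b" Y "m a e" "m c e"] mD(1,3) assms by metis
  then show ?thesis using mD(4)[OF assms(2,3,5)] mD(4)[OF assms(5,2,4)] by argo
qed

text \<open>Rounding down, rather than to the nearest multiple of \<open>1 / 2 ^ n\<close>, keeps
  the approximation of a point of the unit interval inside that interval.\<close>

lemma dyadic_approx:
  fixes t e :: real
  assumes "0 \<le> t" "e > 0"
  obtains n k where "\<bar>real k / 2 ^ n - t\<bar> < e" "real k / 2 ^ n \<le> t"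
proof -
  obtain n where n: "(1 / 2) ^ n < e" using real_arch_pow_inv[OF assms(2), of "1 / 2"] by auto
  let ?k = "nat \<lfloor>2 ^ n * t\<rfloor>"
  have k: "real ?k = of_int \<lfloor>2 ^ n * t\<rfloor>" using assms by simp
  have "real ?k \<le> 2 ^ n * t" "2 ^ n * t < real ?k + 1" unfolding k by linarith+
  then have le: "real ?k / 2 ^ n \<le> t" and "t < real ?k / 2 ^ n + (1 / 2) ^ n"
    by (simp_all add: field_simps power_one_over)
  with n have "\<bar>real ?k / 2 ^ n - t\<bar> < e" by linarith
  with le that show thesis by blast
qed

section \<open>The dyadic grid, iterated midpoints, and the geodesic through them\<close>

lemma dyadic_grid_iff:
  "t \<in> dyadic_grid n \<longleftrightarrow> (\<exists>k\<le>2 ^ n. t = real k / 2 ^ n)"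
proof
  assume "t \<in> dyadic_grid n"
  then obtain k :: int where k: "t = of_int k / 2 ^ n" "0 \<le> t" "t \<le> 1"
    by (auto simp: dyadic_grid_def)
  have "0 \<le> t * 2 ^ n" using k(2) by simp
  then have "0 \<le> real_of_int k" unfolding k(1) by simp
  then have "0 \<le> k" by simp
  moreover have "t * 2 ^ n \<le> 1 * 2 ^ n" using k(3) by (intro mult_right_mono) auto
  then have "real_of_int k \<le> real_of_int (2 ^ n)" unfolding k(1) by simp
  then have "k \<le> 2 ^ n" by (simp only: of_int_le_iff)
  ultimately have "nat k \<le> 2 ^ n" "t = real (nat k) / 2 ^ n"
    using k by (simp_all add: nat_le_iff)
  then show "\<exists>k\<le>2 ^ n. t = real k / 2 ^ n" by blast
next
  assume "\<exists>k\<le>2 ^ n. t = real k / 2 ^ n"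
  then obtain k where k: "k \<le> 2 ^ n" "t = real k / 2 ^ n" by blast
  have "real k \<le> 2 ^ n" using k(1) by (metis of_nat_le_iff of_nat_numeral of_nat_power)
  then have "real k / 2 ^ n \<le> 1" by (simp add: field_simps)
  then have "t \<in> {0..1}" unfolding k(2) atLeastAtMost_iff by simp
  moreover have "t = of_int (int k) / 2 ^ n" using k(2) by simp
  ultimately show "t \<in> dyadic_grid n" unfolding dyadic_grid_def by blast
qed

text \<open>The index \<open>k\<close> is not bounded by \<open>2 ^ n\<close>: the net is constantly \<open>y\<close> from there on.\<close>

fun dyadic_net :: "('a \<Rightarrow> 'a \<Rightarrow> 'a) \<Rightarrow> 'a \<Rightarrow> 'a \<Rightarrow> nat \<Rightarrow> nat \<Rightarrow> 'a" where
  "dyadic_net m x y 0 k = (if k = 0 then x else y)"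
| "dyadic_net m x y (Suc n) k =
    (if even k then dyadic_net m x y n (k div 2)
     else m (dyadic_net m x y n (k div 2)) (dyadic_net m x y n (Suc (k div 2))))"

text \<open>Even indices are copied from the coarser level, so a net point depends only on the
  dyadic number \<open>k / 2 ^ n\<close> and not on its representation. Points of different levels
  can thus be compared at a common level.\<close>

lemma dyadic_net_refine: "dyadic_net m x y (n + i) (2 ^ i * k) = dyadic_net m x y n k"
  by (induction i) (auto simp: mult.assoc)

context
  fixes Y :: "'a metric" and m x y
  assumes m: "conical_midpoint_map Y m" and xy: "x \<in> mspace Y" "y \<in> mspace Y"
begin

lemma dyadic_net_in: "dyadic_net m x y n k \<in> mspace Y"
  by (induction n arbitrary: k) (auto simp: xy conical_midpoint_mapD(1)[OF m])

text \<open>Since \<open>a = m a a\<close> and \<open>b = m b b\<close>, the conical inequality puts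
  \<open>m a b\<close> within half the distance of \<open>a\<close> and \<open>b\<close> from either
  of them, so each refinement halves the gaps. The parity of \<open>k\<close> decides which half is
  meant.\<close>

lemma dyadic_net_step:
  "mdist Y (dyadic_net m x y n k) (dyadic_net m x y n (Suc k)) \<le> mdist Y x y / 2 ^ n"
proof (induction n arbitrary: k)
  case 0
  then show ?case using xy by auto
next
  case (Suc n)
  let ?a = "dyadic_net m x y n (k div 2)" and ?b = "dyadic_net m x y n (Suc (k div 2))"
  note mD = conical_midpoint_mapD[OF m]
  have in': "?a \<in> mspace Y" "?b \<in> mspace Y" by (rule dyadic_net_in)+
  have "mdist Y ?a (m ?a ?b) \<le> mdist Y ?a ?b / 2"
    using mD(4)[OF in'(1) in'] mD(2)[OF in'(1)] by simp
  moreover have "mdist Y (m ?a ?b) ?b \<le> mdist Y ?a ?b / 2"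
    using mD(4)[OF in'(2) in'] mD(2)[OF in'(2)] mD(3)[OF in'] by simp
  moreover have "mdist Y ?a ?b / 2 \<le> mdist Y x y / 2 ^ Suc n"
    using Suc[of "k div 2"] by (simp add: field_simps)
  ultimately show ?case by auto
qed

lemma dyadic_net_same_level:
  "mdist Y (dyadic_net m x y n k) (dyadic_net m x y n l)
    \<le> mdist Y x y * \<bar>real k / 2 ^ n - real l / 2 ^ n\<bar>"
proof -
  have shift: "mdist Y (dyadic_net m x y n k) (dyadic_net m x y n (k + i))
      \<le> mdist Y x y * (real i / 2 ^ n)" for k i
  proof (induction i)
    case 0
    then show ?case using dyadic_net_in by simp
  next
    case (Suc i)
    have "mdist Y (dyadic_net m x y n k) (dyadic_net m x y n (Suc (k + i)))
        \<le> mdist Y x y * (real i / 2 ^ n) + mdist Y x y / 2 ^ n"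
      using mdist_triangle[OF dyadic_net_in[of n k] dyadic_net_in[of n "k + i"]
          dyadic_net_in[of n "Suc (k + i)"]] Suc dyadic_net_step[of n "k + i"] by linarith
    then show ?case by (simp add: field_simps)
  qed
  show ?thesis
  proof (cases "k \<le> l")
    case True
    then have "\<bar>real k / 2 ^ n - real l / 2 ^ n\<bar> = real (l - k) / 2 ^ n"
      by (simp add: field_simps of_nat_diff flip: diff_divide_distrib)
    then show ?thesis using shift[of k "l - k"] True by simp
  next
    case False
    then have "\<bar>real k / 2 ^ n - real l / 2 ^ n\<bar> = real (k - l) / 2 ^ n"
      by (simp add: field_simps of_nat_diff flip: diff_divide_distrib)
    then show ?thesis using shift[of l "k - l"] False by (simp add: mdist_commute)
  qed
qed

lemma dyadic_net_dist:
  "mdist Y (dyadic_net m x y n k) (dyadic_net m x y n' k')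
    \<le> mdist Y x y * \<bar>real k / 2 ^ n - real k' / 2 ^ n'\<bar>"
proof -
  have "dyadic_net m x y n k = dyadic_net m x y (n + n') (2 ^ n' * k)"
    "dyadic_net m x y n' k' = dyadic_net m x y (n + n') (2 ^ n * k')"
    using dyadic_net_refine[of m x y n n' k] dyadic_net_refine[of m x y n' n k']
    by (simp_all add: add.commute)
  then show ?thesis using dyadic_net_same_level[of "n + n'" "2 ^ n' * k" "2 ^ n * k'"]
    by (simp add: power_add)
qed

text \<open>In the dyadic parameter the net is Lipschitz with constant \<open>mdist Y x y\<close>,
  so it extends to the unit interval by \<open>complete_extension\<close>, with the pairs
  \<open>(n, k)\<close> as nodes. The midpoint rule is the odd clause of the recursion for the
  net.\<close>

lemma dyadic_geodesic_exists:
  assumes "mcomplete_of Y"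
  shows "\<exists>c. geodesic Y c \<and> c 0 = x \<and> c 1 = y \<and> dyadic_midpoint_rule m c"
proof -
  let ?p = "\<lambda>n k. dyadic_net m x y n k"
  let ?D = "mdist Y x y"
  obtain c where c: "\<And>t. t \<in> {0..1} \<Longrightarrow> c t \<in> mspace Y"
    and close: "\<And>n k t. t \<in> {0..1} \<Longrightarrow> mdist Y (?p n k) (c t) \<le> ?D * \<bar>real k / 2 ^ n - t\<bar>"
  proof (rule complete_extension[where Y = Y and S = UNIV and T = "{0..1::real}"
        and f = "\<lambda>(n, k). ?p n k" and D = "\<lambda>(n, k) t. ?D * \<bar>real k / 2 ^ n - t\<bar>"])
    show "mcomplete_of Y" by fact
    show "(case u of (n, k) \<Rightarrow> ?p n k) \<in> mspace Y" for u
      by (cases u) (simp add: dyadic_net_in)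
  next
    fix t e :: real assume t: "t \<in> {0..1}" and e: "e > 0"
    \<comment> \<open>Division is by \<open>?D + 1\<close> because \<open>?D\<close> is 0 if
      \<open>x = y\<close>.\<close>
    have pos: "?D + 1 > 0" using mdist_nonneg[of Y x y] by linarith
    obtain n k where nk: "\<bar>real k / 2 ^ n - t\<bar> < e / (?D + 1)" "real k / 2 ^ n \<le> t"
      by (rule dyadic_approx[of t "e / (?D + 1)"]) (use t e pos in auto)
    then have "(?D + 1) * \<bar>real k / 2 ^ n - t\<bar> < e" using pos by (simp add: pos_less_divide_eq mult.commute)
    moreover have "?D * \<bar>real k / 2 ^ n - t\<bar> \<le> (?D + 1) * \<bar>real k / 2 ^ n - t\<bar>"
      by (intro mult_right_mono) auto
    ultimately show "\<exists>u\<in>UNIV. (case u of (n, k) \<Rightarrow> \<lambda>t. ?D * \<bar>real k / 2 ^ n - t\<bar>) t < e"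
      by (intro bexI[of _ "(n, k)"]) auto
  next
    fix u v :: "nat \<times> nat" and t :: real
    obtain n k n' k' where uv: "u = (n, k)" "v = (n', k')" by fastforce
    have "?D * \<bar>real k / 2 ^ n - real k' / 2 ^ n'\<bar>
        \<le> ?D * (\<bar>real k / 2 ^ n - t\<bar> + \<bar>real k' / 2 ^ n' - t\<bar>)"
      by (intro mult_left_mono) auto
    then show "mdist Y (case u of (n, k) \<Rightarrow> ?p n k) (case v of (n, k) \<Rightarrow> ?p n k)
        \<le> (case u of (n, k) \<Rightarrow> \<lambda>t. ?D * \<bar>real k / 2 ^ n - t\<bar>) t
          + (case v of (n, k) \<Rightarrow> \<lambda>t. ?D * \<bar>real k / 2 ^ n - t\<bar>) t"
      using dyadic_net_dist[of n k n' k'] uv by (simp add: distrib_left)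
  qed fastforce
  \<comment> \<open>At the parameter of a node the bound \<open>close\<close> is 0, so the curve
    passes through the net.\<close>
  have grid: "c (real k / 2 ^ n) = ?p n k" if "real k / 2 ^ n \<in> {0..1}" for n k
  proof -
    have "mdist Y (?p n k) (c (real k / 2 ^ n)) \<le> 0" using close[OF that, of n k] by simp
    then show ?thesis using mdist_zero[of "?p n k" Y] c[OF that] dyadic_net_in[of n k]
      by (metis mdist_nonneg order_antisym)
  qed
  have c0: "c 0 = x" and c1: "c 1 = y" using grid[of 0 0] grid[of 1 0] by auto
  have upper: "mdist Y (c s) (c t) \<le> ?D * \<bar>s - t\<bar>" if st: "s \<in> {0..1}" "t \<in> {0..1}" for s t
  proof (rule le_if_le_add_mult[where C = "2 * ?D"])
    fix e :: real assume e: "e > 0"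
    obtain n k where nk: "\<bar>real k / 2 ^ n - s\<bar> < e" "real k / 2 ^ n \<le> s"
      by (rule dyadic_approx[of s e]) (use st e in auto)
    have "mdist Y (c s) (c t) \<le> mdist Y (?p n k) (c s) + mdist Y (?p n k) (c t)"
      using mdist_triangle[of "c s" Y "?p n k" "c t"] c st dyadic_net_in
      by (simp add: mdist_commute)
    also have "\<dots> \<le> ?D * (\<bar>real k / 2 ^ n - s\<bar> + \<bar>real k / 2 ^ n - t\<bar>)"
      using close[OF st(1), of n k] close[OF st(2), of n k] by (simp add: distrib_left)
    also have "\<dots> \<le> ?D * (\<bar>s - t\<bar> + 2 * e)" using nk by (intro mult_left_mono) auto
    finally show "mdist Y (c s) (c t) \<le> ?D * \<bar>s - t\<bar> + 2 * ?D * e" by (simp add: algebra_simps)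
  qed
  text \<open>A curve on \<open>[0, 1]\<close> that is Lipschitz with the distance of its endpoints as constant is a geodesic.\<close>
  have lower: "mdist Y (c s) (c t) \<ge> ?D * \<bar>s - t\<bar>"
    if st: "s \<in> {0..1}" "t \<in> {0..1}" "s \<le> t" for s t
  proof -
    have "?D \<le> mdist Y (c 0) (c s) + mdist Y (c s) (c t) + mdist Y (c t) (c 1)"
      using mdist_triangle[of "c 0" Y "c s" "c 1"] mdist_triangle[of "c s" Y "c t" "c 1"] c st
      unfolding c0 c1 using xy by force
    moreover have "mdist Y (c 0) (c s) \<le> ?D * s" "mdist Y (c t) (c 1) \<le> ?D * (1 - t)"
      using upper[of 0 s] upper[of t 1] st by auto
    ultimately show ?thesis using st by (simp add: algebra_simps)
  qed
  have "mdist Y (c s) (c t) = \<bar>s - t\<bar> * ?D" if "s \<in> {0..1}" "t \<in> {0..1}" for s t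
    using upper[of s t] lower[of s t] lower[of t s] that
    by (cases "s \<le> t") (auto simp: mdist_commute abs_minus_commute mult.commute intro: antisym)
  then have "geodesic Y c" unfolding geodesic_def c0 c1 using c by auto
  moreover have "dyadic_midpoint_rule m c"
    unfolding dyadic_midpoint_rule_def
  proof (intro allI impI ballI, elim conjE)
    fix n :: nat and t r s
    assume n: "1 \<le> n" and "t \<in> dyadic_grid n - dyadic_grid (n - 1)"
      and r: "r \<in> dyadic_grid (n - 1)" and s: "s \<in> dyadic_grid (n - 1)"
      and t: "t = r / 2 + s / 2" and rs: "\<bar>r - s\<bar> = 1 / 2 ^ (n - 1)"
    obtain N where N: "n = Suc N" using n by (cases n) auto
    \<comment> \<open>For neighbours in increasing order the parameter in the middle has odd
      numerator one level up, where the net takes a midpoint. The decreasing order follows by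
      symmetry of \<open>m\<close>.\<close>
    have half: "c (r' / 2 + s' / 2) = m (c r') (c s')"
      if r': "r' \<in> dyadic_grid N" and s': "s' \<in> dyadic_grid N" and "s' - r' = 1 / 2 ^ N" for r' s'
    proof -
      obtain k l where k: "k \<le> 2 ^ N" "r' = real k / 2 ^ N" and l: "l \<le> 2 ^ N" "s' = real l / 2 ^ N"
        using r' s' unfolding dyadic_grid_iff by blast
      have "real l = real (Suc k)" using that(3) unfolding k l by (simp add: field_simps)
      then have lk: "l = Suc k" by linarith
      have in01: "r' \<in> {0..1}" "s' \<in> {0..1}" using r' s' by (auto simp: dyadic_grid_def)
      have mid: "r' / 2 + s' / 2 = real (2 * k + 1) / 2 ^ Suc N"
        unfolding k l lk by (simp add: field_simps)
      moreover have "r' / 2 + s' / 2 \<in> {0..1}" using in01 by auto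
      ultimately have "c (r' / 2 + s' / 2) = ?p (Suc N) (2 * k + 1)" using grid by metis
      also have "\<dots> = m (?p N k) (?p N (Suc k))" by simp
      also have "\<dots> = m (c r') (c s')" using grid[of k N] grid[of l N] in01 k l lk by simp
      finally show ?thesis .
    qed
    have in': "c r \<in> mspace Y" "c s \<in> mspace Y"
      using r s by (auto simp: dyadic_grid_def intro: c)
    show "c t = m (c r) (c s)"
    proof (cases "r \<le> s")
      case True
      then show ?thesis using half[of r s] r s rs t N by simp
    next
      case False
      then have "c (s / 2 + r / 2) = m (c s) (c r)" using half[of s r] r s rs N by simp
      then show ?thesis using conical_midpoint_mapD(3)[OF m in'] t by (simp add: add.commute)
    qed
  qed
  ultimately show ?thesis using c0 c1 by blast
qed

lemma induced_bicombing:
  assumes "mcomplete_of Y"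
  shows "geodesic Y (induced_bicombing Y m x y)"
    and "induced_bicombing Y m x y 0 = x" and "induced_bicombing Y m x y 1 = y"
    and "dyadic_midpoint_rule m (induced_bicombing Y m x y)"
  using someI_ex[OF dyadic_geodesic_exists[OF assms]] unfolding induced_bicombing_def by auto

end

section \<open>Uniqueness of curves obeying the midpoint rule, and images of induced
  geodesics\<close>

text \<open>Induction on the level: a grid point that is new at the next level has odd numerator,
  hence lies midway between two neighbours of the current level, where the curves agree
  already.\<close>

lemma dyadic_midpoint_rule_unique:
  assumes "c 0 = c' 0" "c 1 = c' 1" "dyadic_midpoint_rule m c" "dyadic_midpoint_rule m c'"
  shows "t \<in> dyadic_grid n \<Longrightarrow> c t = c' t"
proof (induction n arbitrary: t)
  case 0
  then obtain k where "k \<le> 1" "t = real k" by (auto simp: dyadic_grid_iff)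
  then have "t = 0 \<or> t = 1" by (auto simp: le_Suc_eq)
  then show ?case using assms by auto
next
  case (Suc n)
  show ?case
  proof (cases "t \<in> dyadic_grid n")
    case False
    obtain k where k: "k \<le> 2 ^ Suc n" "t = real k / 2 ^ Suc n"
      using Suc.prems unfolding dyadic_grid_iff by blast
    have "odd k"
    proof
      assume "even k"
      then obtain l where "k = 2 * l" by blast
      then have "l \<le> 2 ^ n" "t = real l / 2 ^ n" using k by auto
      then show False using False unfolding dyadic_grid_iff by blast
    qed
    then obtain l where l: "k = 2 * l + 1" by (elim oddE)
    let ?r = "real l / 2 ^ n" and ?s = "real (Suc l) / 2 ^ n"
    have "l \<le> 2 ^ n" "Suc l \<le> 2 ^ n" using k(1) l by auto
    then have rs: "?r \<in> dyadic_grid n" "?s \<in> dyadic_grid n" unfolding dyadic_grid_iff by blast+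
    have "t = ?r / 2 + ?s / 2" "\<bar>?r - ?s\<bar> = 1 / 2 ^ n"
      using k l by (auto simp: field_simps simp flip: diff_divide_distrib)
    then have "d t = m (d ?r) (d ?s)" if "dyadic_midpoint_rule m d" for d
      using that Suc.prems False rs unfolding dyadic_midpoint_rule_def
      by (metis DiffI One_nat_def Suc_le_mono diff_Suc_1 zero_le)
    then show ?thesis using assms(3,4) Suc.IH rs by metis
  qed (use Suc.IH in auto)
qed

text \<open>Dyadic parameters are dense, and a Lipschitz curve is determined by its values on a
  dense set. Lipschitz bounds are assumed instead of geodesics because one of the curves will be the
  image of a geodesic under a Lipschitz map.\<close>

lemma dyadic_midpoint_rule_unique_Lipschitz:
  fixes c c' :: "real \<Rightarrow> 'a" and B B' :: real
  assumes "c 0 = c' 0" "c 1 = c' 1" "dyadic_midpoint_rule m c" "dyadic_midpoint_rule m c'"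
    and c: "c \<in> {0..1} \<rightarrow> mspace Y" and c': "c' \<in> {0..1} \<rightarrow> mspace Y"
    and lip: "\<And>s t. s \<in> {0..1} \<Longrightarrow> t \<in> {0..1} \<Longrightarrow> mdist Y (c s) (c t) \<le> B * \<bar>s - t\<bar>"
    and lip': "\<And>s t. s \<in> {0..1} \<Longrightarrow> t \<in> {0..1} \<Longrightarrow> mdist Y (c' s) (c' t) \<le> B' * \<bar>s - t\<bar>"
    and t: "t \<in> {0..1}"
  shows "c t = c' t"
proof -
  have "mdist Y (c t) (c' t) \<le> 0"
  proof (rule le_if_le_add_mult[where C = "\<bar>B\<bar> + \<bar>B'\<bar>"])
    fix e :: real assume e: "e > 0"
    obtain n k where nk: "\<bar>real k / 2 ^ n - t\<bar> < e" "real k / 2 ^ n \<le> t"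
      by (rule dyadic_approx[of t e]) (use t e in auto)
    let ?s = "real k / 2 ^ n"
    have "?s \<le> 1" using nk(2) t unfolding atLeastAtMost_iff by linarith
    then have s: "?s \<in> {0..1}" unfolding atLeastAtMost_iff by simp
    from \<open>?s \<le> 1\<close> have "real k \<le> real (2 ^ n)" by (simp add: field_simps)
    then have "k \<le> 2 ^ n" by (simp only: of_nat_le_iff)
    then have "?s \<in> dyadic_grid n" unfolding dyadic_grid_iff by blast
    then have eq: "c ?s = c' ?s" using dyadic_midpoint_rule_unique assms(1-4) by metis
    have "mdist Y (c t) (c' t) \<le> mdist Y (c ?s) (c t) + mdist Y (c' ?s) (c' t)"
      using mdist_triangle[of "c t" Y "c ?s" "c' t"] c c' s t eq
      by (simp add: Pi_iff mdist_commute)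
    also have "\<dots> \<le> B * \<bar>?s - t\<bar> + B' * \<bar>?s - t\<bar>"
      using lip[OF s t] lip'[OF s t] by linarith
    also have "\<dots> \<le> (\<bar>B\<bar> + \<bar>B'\<bar>) * \<bar>?s - t\<bar>"
      using mult_right_mono[of "B + B'" "\<bar>B\<bar> + \<bar>B'\<bar>" "\<bar>?s - t\<bar>"] by (simp add: algebra_simps)
    also have "\<dots> \<le> (\<bar>B\<bar> + \<bar>B'\<bar>) * e" using nk by (intro mult_left_mono) auto
    finally show "mdist Y (c t) (c' t) \<le> 0 + (\<bar>B\<bar> + \<bar>B'\<bar>) * e" by simp
  qed
  then show ?thesis using c c' t mdist_zero[of "c t" Y "c' t"]
    by (metis Pi_iff mdist_nonneg order_antisym)
qed

text \<open>The image under \<open>\<Phi>\<close> of the geodesic induced by \<open>m\<close> obeys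
  the midpoint rule for \<open>m'\<close> and has the right endpoints. By uniqueness it is the
  geodesic induced by \<open>m'\<close>, which therefore stays in the image of
  \<open>\<Phi>\<close>.\<close>

lemma bicombing_convex_image:
  assumes X: "mcomplete_of X" "conical_midpoint_map X m"
    and Y: "mcomplete_of Y" "conical_midpoint_map Y m'"
    and \<Phi>: "Lipschitz_continuous_map X Y \<Phi>"
    and hom: "\<And>x y. x \<in> mspace X \<Longrightarrow> y \<in> mspace X \<Longrightarrow> \<Phi> (m x y) = m' (\<Phi> x) (\<Phi> y)"
  shows "bicombing_convex Y (induced_bicombing Y m') (\<Phi> ` mspace X)"
proof -
  obtain B where \<Phi>_in: "\<Phi> \<in> mspace X \<rightarrow> mspace Y"
    and B: "\<And>x y. x \<in> mspace X \<Longrightarrow> y \<in> mspace X \<Longrightarrow> mdist Y (\<Phi> x) (\<Phi> y) \<le> B * mdist X x y"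
    using \<Phi> unfolding Lipschitz_continuous_map_def by blast
  have "induced_bicombing Y m' (\<Phi> x) (\<Phi> y) t \<in> \<Phi> ` mspace X"
    if xy: "x \<in> mspace X" "y \<in> mspace X" and t: "t \<in> {0..1}" for x y t
  proof -
    define c where "c = induced_bicombing X m x y"
    define c' where "c' = induced_bicombing Y m' (\<Phi> x) (\<Phi> y)"
    note c = induced_bicombing[OF X(2) xy X(1), folded c_def]
    have \<Phi>xy: "\<Phi> x \<in> mspace Y" "\<Phi> y \<in> mspace Y" using \<Phi>_in xy by auto
    note c' = induced_bicombing[OF Y(2) \<Phi>xy Y(1), folded c'_def]
    have c_in: "c \<in> {0..1} \<rightarrow> mspace X" and c'_in: "c' \<in> {0..1} \<rightarrow> mspace Y"
      using c(1) c'(1) by (auto simp: geodesic_def)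
    have "c' t = (\<Phi> \<circ> c) t"
    proof (rule dyadic_midpoint_rule_unique_Lipschitz[where Y = Y and m = m'])
      show "c' 0 = (\<Phi> \<circ> c) 0" "c' 1 = (\<Phi> \<circ> c) 1" using c c' by auto
      show "dyadic_midpoint_rule m' c'" by (rule c')
      show "dyadic_midpoint_rule m' (\<Phi> \<circ> c)"
        unfolding dyadic_midpoint_rule_def
      proof (intro allI impI ballI)
        fix n :: nat and u r s
        assume *: "1 \<le> n" "u \<in> dyadic_grid n - dyadic_grid (n - 1)"
          "r \<in> dyadic_grid (n - 1)" "s \<in> dyadic_grid (n - 1)"
          "u = r / 2 + s / 2 \<and> \<bar>r - s\<bar> = 1 / 2 ^ (n - 1)"
        then have "c u = m (c r) (c s)" using c(4) unfolding dyadic_midpoint_rule_def by blast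
        moreover have "c r \<in> mspace X" "c s \<in> mspace X"
          using c_in * unfolding dyadic_grid_def by auto
        ultimately show "(\<Phi> \<circ> c) u = m' ((\<Phi> \<circ> c) r) ((\<Phi> \<circ> c) s)" using hom by simp
      qed
      show "c' \<in> {0..1} \<rightarrow> mspace Y" by (rule c'_in)
      show "\<Phi> \<circ> c \<in> {0..1} \<rightarrow> mspace Y" using c_in \<Phi>_in by auto
      show "mdist Y (c' s) (c' t) \<le> mdist Y (c' 0) (c' 1) * \<bar>s - t\<bar>"
        if "s \<in> {0..1}" "t \<in> {0..1}" for s t
        using c'(1) that unfolding geodesic_def by (metis mult.commute order_refl)
      show "mdist Y ((\<Phi> \<circ> c) s) ((\<Phi> \<circ> c) t) \<le> (B * mdist X (c 0) (c 1)) * \<bar>s - t\<bar>"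
        if "s \<in> {0..1}" "t \<in> {0..1}" for s t
      proof -
        have "mdist X (c s) (c t) = \<bar>s - t\<bar> * mdist X (c 0) (c 1)"
          using c(1) that unfolding geodesic_def by blast
        then show ?thesis using B[of "c s" "c t"] c_in that by (auto simp: Pi_iff algebra_simps)
      qed
    qed (rule t)
    then show ?thesis unfolding c'_def using c_in t by auto
  qed
  then show ?thesis unfolding bicombing_convex_def using \<Phi>_in by auto
qed

section \<open>The midpoint map of the completion of \<open>V\<close>\<close>

lemma Vn_mono: "n \<le> n' \<Longrightarrow> Vn j n \<subseteq> Vn j n'"
proof (rule lift_Suc_mono_le[of "Vn j"])
  show "Vn j n \<subseteq> Vn j (Suc n)" for n by (fastforce simp: mid_def)
qed

lemma mid_in_Vset:
  assumes "a \<in> Vset j" "b \<in> Vset j"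
  shows "mid a b \<in> Vset j"
proof -
  obtain n n' where "a \<in> Vn j n" "b \<in> Vn j n'" using assms unfolding Vset_def by blast
  then have "a \<in> Vn j (max n n')" "b \<in> Vn j (max n n')"
    using Vn_mono[of n "max n n'" j] Vn_mono[of n' "max n n'" j] by auto
  then have "mid a b \<in> Vn j (Suc (max n n'))" by auto
  then show ?thesis unfolding Vset_def by blast
qed

lemma mid_commute: "mid a b = mid b a"
  by (simp add: mid_def doubleton_fset_eq_iff)

text \<open>For two proper pairs this is one of the four terms of the minimum defining
  \<open>dV\<close>; for a degenerate pair it is the bound that splits only the other one. It is the
  conical inequality on \<open>V\<close>, and also what lets \<open>mid\<close> extend to the
  completion.\<close>

lemma dV_mid_mid_le:
  assumes "a \<in> Vset j" "b \<in> Vset j" "c \<in> Vset j" "e \<in> Vset j"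
  shows "dV (mid a b) (mid c e) \<le> (dV a c + dV b e) / 2"
proof (cases "a = b")
  case True
  then show ?thesis
    using dV_split_le[OF assms(1), of c e] by (cases "c = e") (auto simp: mid_def)
next
  case False
  then show ?thesis
    using dV_split_le[OF assms(3), of a b] dV_match_le[of a b c e]
    by (cases "c = e") (auto simp: mid_def dV_commute)
qed

context
  fixes j :: nat and X :: "'x metric" and \<iota> :: "hset \<Rightarrow> 'x"
  assumes compl: "is_metric_completion (V_metric j) X \<iota>"
begin

lemma completion_in: "u \<in> Vset j \<Longrightarrow> \<iota> u \<in> mspace X"
  using compl unfolding is_metric_completion_def by auto

lemma completion_dist: "u \<in> Vset j \<Longrightarrow> v \<in> Vset j \<Longrightarrow> mdist X (\<iota> u) (\<iota> v) = dV u v"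
  using compl unfolding is_metric_completion_def by auto

lemma completion_dense:
  assumes "x \<in> mspace X" "e > 0"
  obtains u where "u \<in> Vset j" "mdist X (\<iota> u) x < e"
proof -
  have "x \<in> mtopology_of X closure_of (\<iota> ` Vset j)"
    using compl assms unfolding is_metric_completion_def by auto
  then have "\<exists>y\<in>\<iota> ` Vset j. y \<in> Metric_space.mball (mspace X) (mdist X) x e"
    using Metric_space.metric_closure_of[of "mspace X" "mdist X"] assms
    unfolding mtopology_of_def by fastforce
  then show thesis using that
    by (auto simp: Metric_space.in_mball mdist_commute)
qed

text \<open>This provides the hypothesis \<open>le\<close> of \<open>complete_extension\<close> in
  both extensions from \<open>V\<close> to its completion, that of \<open>mid\<close> and that of
  the evaluation map.\<close>

lemma completion_dist_approx:
  assumes "x \<in> mspace X" "u \<in> Vset j" "v \<in> Vset j"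
  shows "dV u v \<le> mdist X (\<iota> u) x + mdist X (\<iota> v) x"
  using mdist_triangle[of "\<iota> u" X x "\<iota> v"] completion_in completion_dist assms
  by (simp add: mdist_commute)

text \<open>Extend \<open>mid\<close> by \<open>complete_extension\<close> with pairs from
  \<open>V\<close> as nodes, half the sum of the two distances measuring how far a node is from a
  pair of points. Each axiom then holds up to an arbitrarily small error by comparison with
  nodes.\<close>

lemma completion_midpoint_map_exists:
  obtains m where "conical_midpoint_map X m"
    and "\<And>u v. u \<in> Vset j \<Longrightarrow> v \<in> Vset j \<Longrightarrow> m (\<iota> u) (\<iota> v) = \<iota> (mid u v)"
proof -
  obtain M where M: "\<And>p. p \<in> mspace X \<times> mspace X \<Longrightarrow> M p \<in> mspace X"
    and close': "\<And>w p. w \<in> Vset j \<times> Vset j \<Longrightarrow> p \<in> mspace X \<times> mspace X \<Longrightarrow>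
      mdist X (\<iota> (mid (fst w) (snd w))) (M p)
        \<le> (mdist X (\<iota> (fst w)) (fst p) + mdist X (\<iota> (snd w)) (snd p)) / 2"
  proof (rule complete_extension[where Y = X and S = "Vset j \<times> Vset j" and T = "mspace X \<times> mspace X"
        and f = "\<lambda>w. \<iota> (mid (fst w) (snd w))"
        and D = "\<lambda>w p. (mdist X (\<iota> (fst w)) (fst p) + mdist X (\<iota> (snd w)) (snd p)) / 2"])
    show "mcomplete_of X" using compl by (simp add: is_metric_completion_def)
    show "\<iota> (mid (fst w) (snd w)) \<in> mspace X" if "w \<in> Vset j \<times> Vset j" for w
      using that completion_in mid_in_Vset by auto
  next
    fix p and e :: real assume p: "p \<in> mspace X \<times> mspace X" and e: "e > 0"
    obtain u v where "u \<in> Vset j" "mdist X (\<iota> u) (fst p) < e" "v \<in> Vset j" "mdist X (\<iota> v) (snd p) < e"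
      using completion_dense p e by (metis mem_Times_iff)
    then show "\<exists>w\<in>Vset j \<times> Vset j.
        (mdist X (\<iota> (fst w)) (fst p) + mdist X (\<iota> (snd w)) (snd p)) / 2 < e"
      by (intro bexI[of _ "(u, v)"]) auto
  next
    fix w z p assume *: "w \<in> Vset j \<times> Vset j" "z \<in> Vset j \<times> Vset j" "p \<in> mspace X \<times> mspace X"
    then have in': "fst w \<in> Vset j" "snd w \<in> Vset j" "fst z \<in> Vset j" "snd z \<in> Vset j"
      "fst p \<in> mspace X" "snd p \<in> mspace X" by auto
    have "mdist X (\<iota> (mid (fst w) (snd w))) (\<iota> (mid (fst z) (snd z)))
        \<le> (dV (fst w) (fst z) + dV (snd w) (snd z)) / 2"
      using in' dV_mid_mid_le[of "fst w" j "snd w" "fst z" "snd z"]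
      by (simp add: completion_dist mid_in_Vset)
    then show "mdist X (\<iota> (mid (fst w) (snd w))) (\<iota> (mid (fst z) (snd z)))
        \<le> (mdist X (\<iota> (fst w)) (fst p) + mdist X (\<iota> (snd w)) (snd p)) / 2
          + (mdist X (\<iota> (fst z)) (fst p) + mdist X (\<iota> (snd z)) (snd p)) / 2"
      using completion_dist_approx[OF in'(5,1,3)] completion_dist_approx[OF in'(6,2,4)] by argo
  qed blast
  define m where "m x y = M (x, y)" for x y
  have m_in: "m x y \<in> mspace X" if "x \<in> mspace X" "y \<in> mspace X" for x y
    using M that by (simp add: m_def)
  have close: "mdist X (\<iota> (mid u v)) (m x y) \<le> (mdist X (\<iota> u) x + mdist X (\<iota> v) y) / 2"
    if "u \<in> Vset j" "v \<in> Vset j" "x \<in> mspace X" "y \<in> mspace X" for u v x y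
    using close'[of "(u, v)" "(x, y)"] that by (simp add: m_def)
  have mid_in: "\<iota> (mid u v) \<in> mspace X" if "u \<in> Vset j" "v \<in> Vset j" for u v
    using completion_in mid_in_Vset that by blast
  have eqI: "x = y" if "x \<in> mspace X" "y \<in> mspace X" "mdist X x y \<le> 0" for x y
    using that mdist_zero[of x X y] by (metis mdist_nonneg order_antisym)
  have "conical_midpoint_map X m"
    unfolding conical_midpoint_map_def
  proof (intro conjI ballI)
    show "m x y \<in> mspace X" if "x \<in> mspace X" "y \<in> mspace X" for x y using that by (rule m_in)
  next
    fix x assume x: "x \<in> mspace X"
    \<comment> \<open>The node \<open>(u, u)\<close> has midpoint \<open>u\<close>, which is close
      both to \<open>x\<close> and to \<open>m x x\<close>.\<close>
    have "mdist X (m x x) x \<le> 0"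
    proof (rule le_if_le_add_mult[where C = 2])
      fix e :: real assume "e > 0"
      with x obtain u where u: "u \<in> Vset j" "mdist X (\<iota> u) x < e" by (rule completion_dense)
      then show "mdist X (m x x) x \<le> 0 + 2 * e"
        using mdist_triangle[of "m x x" X "\<iota> u" x] close[of u u x x] x m_in completion_in
        by (simp add: mid_def mdist_commute)
    qed
    then show "m x x = x" using eqI m_in x by blast
  next
    fix x y assume x: "x \<in> mspace X" and y: "y \<in> mspace X"
    have "mdist X (m x y) (m y x) \<le> 0"
    proof (rule le_if_le_add_mult[where C = 2])
      fix e :: real assume e: "e > 0"
      obtain u where u: "u \<in> Vset j" "mdist X (\<iota> u) x < e" using x e by (rule completion_dense)
      obtain v where v: "v \<in> Vset j" "mdist X (\<iota> v) y < e" using y e by (rule completion_dense)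
      show "mdist X (m x y) (m y x) \<le> 0 + 2 * e"
        using mdist_triangle[of "m x y" X "\<iota> (mid u v)" "m y x"] close[of u v x y] close[of v u y x]
          x y u v m_in mid_in[of u v] by (simp add: mid_commute[of v u] mdist_commute)
    qed
    then show "m x y = m y x" using eqI m_in x y by blast
  next
    fix x y z assume x: "x \<in> mspace X" and y: "y \<in> mspace X" and z: "z \<in> mspace X"
    show "mdist X (m x y) (m x z) \<le> 1 / 2 * mdist X y z"
    proof (rule le_if_le_add_mult[where C = 3])
      fix e :: real assume e: "e > 0"
      obtain u where u: "u \<in> Vset j" "mdist X (\<iota> u) x < e" using x e by (rule completion_dense)
      obtain v where v: "v \<in> Vset j" "mdist X (\<iota> v) y < e" using y e by (rule completion_dense)
      \<comment> \<open>One node \<open>mid u v\<close> near \<open>m x y\<close> is compared with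
        both midpoints. Against \<open>m x z\<close> it costs half the distance from
        \<open>\<iota> v\<close> to \<open>z\<close>, which up to \<open>e\<close> is the right-hand
        side sought.\<close>
      have "mdist X (m x y) (m x z) \<le> mdist X (\<iota> (mid u v)) (m x y) + mdist X (\<iota> (mid u v)) (m x z)"
        using mdist_triangle[of "m x y" X "\<iota> (mid u v)" "m x z"] x y z u v m_in mid_in[of u v]
        by (simp add: mdist_commute)
      moreover have "mdist X (\<iota> v) z \<le> mdist X (\<iota> v) y + mdist X y z"
        using completion_in v y z by (intro mdist_triangle) auto
      ultimately show "mdist X (m x y) (m x z) \<le> 1 / 2 * mdist X y z + 3 * e"
        using close[OF u(1) v(1) x y] close[OF u(1) v(1) x z] u(2) v(2) e by argo
    qed
  qed
  moreover have "m (\<iota> u) (\<iota> v) = \<iota> (mid u v)" if "u \<in> Vset j" "v \<in> Vset j" for u v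
  proof -
    have "mdist X (\<iota> (mid u v)) (m (\<iota> u) (\<iota> v)) \<le> 0"
      using close[of u v "\<iota> u" "\<iota> v"] that completion_in by simp
    then show ?thesis using eqI m_in mid_in that completion_in by metis
  qed
  ultimately show thesis using that by blast
qed

end

section \<open>Evaluating \<open>V\<close> in a space with a conical midpoint map\<close>

text \<open>The order in which \<open>parents\<close> lists the two parents is arbitrary, but
  symmetry of \<open>m\<close> makes the value independent of it. Terms without parents get
  \<open>m (f 0) (f 0)\<close>, so values stay in \<open>Y\<close> on all of
  \<open>hset\<close>.\<close>

function eval_mid :: "('y \<Rightarrow> 'y \<Rightarrow> 'y) \<Rightarrow> (nat \<Rightarrow> 'y) \<Rightarrow> hset \<Rightarrow> 'y" where
  "eval_mid m f (Atom i) = f i"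
| "eval_mid m f (HSet S) =
    (let (a, b) = parents (HSet S) in m (eval_mid m f a) (eval_mid m f b))"
  by pat_completeness auto
termination
  by (relation "Wellfounded.measure (\<lambda>(m, f, x). size x)") (auto dest!: size_parents)

declare eval_mid.simps(2) [simp del]

context
  fixes Y :: "'y metric" and m :: "'y \<Rightarrow> 'y \<Rightarrow> 'y" and f :: "nat \<Rightarrow> 'y"
  assumes m: "conical_midpoint_map Y m" and f: "\<And>i. f i \<in> mspace Y"
begin

lemma eval_mid_in: "eval_mid m f x \<in> mspace Y"
proof (induction "size x" arbitrary: x rule: less_induct)
  case less
  show ?case
  proof (cases x)
    case (HSet S)
    obtain a b where ab: "parents (HSet S) = (a, b)" by fastforce
    have "eval_mid m f a \<in> mspace Y" "eval_mid m f b \<in> mspace Y"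
      using less size_parents[OF ab[symmetric]] HSet by auto
    then show ?thesis using conical_midpoint_mapD(1)[OF m] by (simp add: HSet eval_mid.simps ab)
  qed (simp add: f)
qed

text \<open>Idempotence of \<open>m\<close> covers \<open>a = b\<close>, where \<open>mid\<close>
  forms no new set; symmetry covers either order of the parents.\<close>

lemma eval_mid_mid: "eval_mid m f (mid a b) = m (eval_mid m f a) (eval_mid m f b)"
proof (cases "a = b")
  case True
  then show ?thesis using conical_midpoint_mapD(2)[OF m] eval_mid_in by (simp add: mid_def)
next
  case False
  then show ?thesis
    using parents_HSet[OF False] conical_midpoint_mapD(3)[OF m eval_mid_in eval_mid_in]
    by (auto simp: mid_def eval_mid.simps)
qed

text \<open>By \<open>dV_forms\<close>, \<open>dV x y\<close> for a pair not made of two atoms is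
  the mean of two distances between pairs of smaller total size, and the conical inequality bounds
  the distance of the images by the corresponding mean.\<close>

lemma eval_mid_dist_le:
  assumes L: "0 \<le> L" "\<And>i k. i < j \<Longrightarrow> k < j \<Longrightarrow> mdist Y (f i) (f k) \<le> L"
    and "x \<in> Vset j" "y \<in> Vset j"
  shows "mdist Y (eval_mid m f x) (eval_mid m f y) \<le> L * dV x y"
  using assms(3,4)
proof (induction "size x + size y" arbitrary: x y rule: less_induct)
  case less
  let ?\<phi> = "eval_mid m f"
  have sz: "size a < size (HSet {|a, b|}) \<and> size b < size (HSet {|a, b|})" for a b
    by (simp add: size_fmember)
  have \<phi>: "?\<phi> (HSet {|a, b|}) = m (?\<phi> a) (?\<phi> b)" if "a \<noteq> b" for a b
    using eval_mid_mid[of a b] that by (simp add: mid_def)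
  have idem: "m (?\<phi> z) (?\<phi> z) = ?\<phi> z" for z
    using conical_midpoint_mapD(2)[OF m eval_mid_in] .
  have conical: "mdist Y (m (?\<phi> a) (?\<phi> b)) (m (?\<phi> c) (?\<phi> e))
      \<le> (mdist Y (?\<phi> a) (?\<phi> c) + mdist Y (?\<phi> b) (?\<phi> e)) / 2" for a b c e
    using conical_midpoint_map_dist_le[OF m] eval_mid_in by blast
  note IH = less.hyps
  show ?case using less.prems
  proof (cases rule: dV_forms)
    case (atoms i k)
    moreover have "i < j" "k < j" using less.prems atoms by (auto elim: Vset_cases)
    ultimately show ?thesis using L f by (auto simp: dV.simps)
  next
    case (right c e)
    have "mdist Y (?\<phi> x) (?\<phi> c) \<le> L * dV x c" "mdist Y (?\<phi> x) (?\<phi> e) \<le> L * dV x e"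
      using IH[of x c] IH[of x e] right less.prems sz[of c e] by auto
    \<comment> \<open>Here \<open>x\<close> is read as the midpoint of \<open>x\<close> with itself,
      so that splitting \<open>y\<close> alone is an instance of \<open>conical\<close>.\<close>
    moreover have "mdist Y (?\<phi> x) (?\<phi> y) \<le> (mdist Y (?\<phi> x) (?\<phi> c) + mdist Y (?\<phi> x) (?\<phi> e)) / 2"
      using conical[of x x c e] right by (simp add: \<phi> idem)
    moreover have "L * dV x y = (L * dV x c + L * dV x e) / 2" unfolding right(5) by (simp add: distrib_left)
    ultimately show ?thesis by argo
  next
    case (left a b)
    have "mdist Y (?\<phi> a) (?\<phi> y) \<le> L * dV a y" "mdist Y (?\<phi> b) (?\<phi> y) \<le> L * dV b y"
      using IH[of a y] IH[of b y] left less.prems sz[of a b] by auto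
    moreover have "mdist Y (?\<phi> x) (?\<phi> y) \<le> (mdist Y (?\<phi> a) (?\<phi> y) + mdist Y (?\<phi> b) (?\<phi> y)) / 2"
      using conical[of a b y y] left by (simp add: \<phi> idem)
    moreover have "L * dV x y = (L * dV a y + L * dV b y) / 2" unfolding left(5) by (simp add: distrib_left)
    ultimately show ?thesis by argo
  next
    case (match a b c e)
    have "mdist Y (?\<phi> a) (?\<phi> c) \<le> L * dV a c" "mdist Y (?\<phi> b) (?\<phi> e) \<le> L * dV b e"
      using IH[of a c] IH[of b e] match sz[of a b] sz[of c e] by auto
    moreover have "mdist Y (?\<phi> x) (?\<phi> y) \<le> (mdist Y (?\<phi> a) (?\<phi> c) + mdist Y (?\<phi> b) (?\<phi> e)) / 2"
      using conical[of a b c e] match by (simp add: \<phi>)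
    moreover have "L * dV x y = (L * dV a c + L * dV b e) / 2" unfolding match(9) by (simp add: distrib_left)
    ultimately show ?thesis by argo
  qed
qed

end

section \<open>The Lipschitz map on the completion and its image\<close>

lemma finite_enumeration_in:
  assumes "finite A" "card A \<le> j" "A \<subseteq> B" "B \<noteq> {}"
  obtains f :: "nat \<Rightarrow> 'a" where "\<And>i. f i \<in> B" "A \<subseteq> f ` {..<j}"
proof -
  obtain b where b: "b \<in> B" using assms by blast
  obtain h where h: "bij_betw h {..<card A} A"
    using ex_bij_betw_nat_finite[OF assms(1)] by (auto simp: atLeast0LessThan)
  \<comment> \<open>The default \<open>b\<close> keeps all values in \<open>B\<close>, also when
    \<open>A\<close> is empty or has fewer than \<open>j\<close> points.\<close>
  define f where "f i = (if i < card A then h i else b)" for i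
  have hA: "h ` {..<card A} = A" using h by (simp add: bij_betw_def)
  then have "f i \<in> B" for i using b assms(3) by (auto simp: f_def)
  moreover have "A \<subseteq> f ` {..<j}"
  proof
    fix a assume "a \<in> A"
    then obtain i where "i < card A" "a = h i" using hA by blast
    then show "a \<in> f ` {..<j}" using assms(2) by (intro image_eqI[of _ _ i]) (auto simp: f_def)
  qed
  ultimately show thesis by (rule that)
qed

theorem theorem6p3:
  fixes j :: nat and X :: "'x metric" and \<iota> :: "hset \<Rightarrow> 'x"
    and Y :: "'y metric" and m\<^sub>Y :: "'y \<Rightarrow> 'y \<Rightarrow> 'y" and A :: "'y set"
  assumes "j \<ge> 1"
    and "is_metric_completion (V_metric j) X \<iota>"
    and "mspace Y \<noteq> {}" and "mcomplete_of Y"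
    and "conical_midpoint_map Y m\<^sub>Y"
    and "A \<subseteq> mspace Y" and "finite A" and "card A \<le> j"
  shows "\<exists>\<Phi>. Lipschitz_continuous_map X Y \<Phi> \<and> A \<subseteq> \<Phi> ` mspace X \<and>
           bicombing_convex Y (induced_bicombing Y m\<^sub>Y) (\<Phi> ` mspace X)"
proof -
  note compl = assms(2) and m\<^sub>Y = assms(5)
  obtain f where f: "\<And>i. f i \<in> mspace Y" "A \<subseteq> f ` {..<j}"
    using finite_enumeration_in[OF assms(7,8,6,3)] by blast
  \<comment> \<open>Any common bound for the distances would do; their sum dominates each of them,
    all terms being nonnegative.\<close>
  define L where "L = (\<Sum>i<j. \<Sum>k<j. mdist Y (f i) (f k))"
  have L0: "0 \<le> L" unfolding L_def by (intro sum_nonneg) auto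
  have Lf: "mdist Y (f i) (f k) \<le> L" if "i < j" "k < j" for i k
  proof -
    have "mdist Y (f i) (f k) \<le> (\<Sum>k<j. mdist Y (f i) (f k))"
      using that by (intro member_le_sum) auto
    also have "\<dots> \<le> L" unfolding L_def
      using that by (intro member_le_sum[of i "{..<j}" "\<lambda>i. \<Sum>k<j. mdist Y (f i) (f k)"])
        (auto intro: sum_nonneg)
    finally show ?thesis .
  qed
  let ?\<phi> = "eval_mid m\<^sub>Y f"
  have \<phi>_in: "?\<phi> u \<in> mspace Y" for u by (rule eval_mid_in[OF m\<^sub>Y f(1)])
  obtain \<Phi> where \<Phi>_in: "\<And>x. x \<in> mspace X \<Longrightarrow> \<Phi> x \<in> mspace Y"
    and close: "\<And>u x. u \<in> Vset j \<Longrightarrow> x \<in> mspace X \<Longrightarrow> mdist Y (?\<phi> u) (\<Phi> x) \<le> L * mdist X (\<iota> u) x"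
  proof (rule complete_extension[where Y = Y and S = "Vset j" and T = "mspace X"
        and f = ?\<phi> and D = "\<lambda>u x. L * mdist X (\<iota> u) x"])
    show "mcomplete_of Y" by fact
    show "?\<phi> u \<in> mspace Y" for u by (rule \<phi>_in)
  next
    fix x and e :: real assume x: "x \<in> mspace X" and e: "e > 0"
    \<comment> \<open>\<open>L\<close> may be 0, hence \<open>L + 1\<close> in the
      denominator.\<close>
    obtain u where u: "u \<in> Vset j" "mdist X (\<iota> u) x < e / (L + 1)"
      using completion_dense[OF compl x, of "e / (L + 1)"] e L0 by auto
    have "L * mdist X (\<iota> u) x \<le> (L + 1) * mdist X (\<iota> u) x" by (intro mult_right_mono) auto
    also have "\<dots> < e" using u(2) L0 by (simp add: field_simps)
    finally show "\<exists>u\<in>Vset j. L * mdist X (\<iota> u) x < e" using u(1) by blast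
  next
    fix u v x assume uvx: "u \<in> Vset j" "v \<in> Vset j" "x \<in> mspace X"
    have "mdist Y (?\<phi> u) (?\<phi> v) \<le> L * dV u v"
      using eval_mid_dist_le[OF m\<^sub>Y f(1) L0 Lf uvx(1,2)] .
    also have "\<dots> \<le> L * (mdist X (\<iota> u) x + mdist X (\<iota> v) x)"
      using completion_dist_approx[OF compl uvx(3,1,2)] L0 by (rule mult_left_mono)
    finally show "mdist Y (?\<phi> u) (?\<phi> v) \<le> L * mdist X (\<iota> u) x + L * mdist X (\<iota> v) x"
      by (simp add: distrib_left)
  qed blast
  have eqI: "y = y'" if "y \<in> mspace Y" "y' \<in> mspace Y" "mdist Y y y' \<le> 0" for y y'
    using that mdist_zero[of y Y y'] by (metis mdist_nonneg order_antisym)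
  \<comment> \<open>At \<open>\<iota> u\<close> the bound \<open>close\<close> is 0. Applied to
    atoms, this will put \<open>A\<close> into the image of \<open>\<Phi>\<close>.\<close>
  have \<Phi>_\<iota>: "\<Phi> (\<iota> u) = ?\<phi> u" if u: "u \<in> Vset j" for u
  proof -
    have \<iota>u: "\<iota> u \<in> mspace X" using completion_in[OF compl u] .
    have "mdist Y (?\<phi> u) (\<Phi> (\<iota> u)) \<le> 0" using close[OF u \<iota>u] \<iota>u by simp
    then show ?thesis using eqI \<phi>_in \<Phi>_in[OF \<iota>u] by metis
  qed
  have lip: "mdist Y (\<Phi> x) (\<Phi> y) \<le> L * mdist X x y" if xy: "x \<in> mspace X" "y \<in> mspace X" for x y
  proof (rule le_if_le_add_mult[where C = "2 * L"])
    fix e :: real assume "e > 0"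
    with compl xy(1) obtain u where u: "u \<in> Vset j" "mdist X (\<iota> u) x < e"
      by (rule completion_dense)
    \<comment> \<open>A single node \<open>u\<close> near \<open>x\<close> serves both points: its
      distance to \<open>y\<close> exceeds that from \<open>x\<close> to \<open>y\<close> by less
      than \<open>e\<close>.\<close>
    have "mdist Y (\<Phi> x) (\<Phi> y) \<le> mdist Y (?\<phi> u) (\<Phi> x) + mdist Y (?\<phi> u) (\<Phi> y)"
      using mdist_triangle[of "\<Phi> x" Y "?\<phi> u" "\<Phi> y"] \<phi>_in \<Phi>_in xy by (simp add: mdist_commute)
    also have "\<dots> \<le> L * (mdist X (\<iota> u) x + mdist X (\<iota> u) y)"
      using close[OF u(1) xy(1)] close[OF u(1) xy(2)] by (simp add: distrib_left)
    also have "\<dots> \<le> L * (mdist X x y + 2 * e)"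
      using mdist_triangle[of "\<iota> u" X x y] completion_in[OF compl] u xy L0
      by (intro mult_left_mono) auto
    finally show "mdist Y (\<Phi> x) (\<Phi> y) \<le> L * mdist X x y + 2 * L * e" by (simp add: algebra_simps)
  qed
  then have Lip: "Lipschitz_continuous_map X Y \<Phi>"
    unfolding Lipschitz_continuous_map_def using \<Phi>_in by blast
  obtain m\<^sub>X where m\<^sub>X: "conical_midpoint_map X m\<^sub>X"
    and mid: "\<And>u v. u \<in> Vset j \<Longrightarrow> v \<in> Vset j \<Longrightarrow> m\<^sub>X (\<iota> u) (\<iota> v) = \<iota> (mid u v)"
    using completion_midpoint_map_exists[OF compl] by blast
  \<comment> \<open>With \<open>u\<close> and \<open>v\<close> near \<open>x\<close> and
    \<open>y\<close>, both sides lie within \<open>L * e\<close> of the evaluation of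
    \<open>mid u v\<close>: the left one because \<open>\<iota> (mid u v)\<close> is near the
    midpoint in \<open>X\<close>, the right one by the conical inequality in
    \<open>Y\<close>.\<close>
  have hom: "\<Phi> (m\<^sub>X x y) = m\<^sub>Y (\<Phi> x) (\<Phi> y)" if xy: "x \<in> mspace X" "y \<in> mspace X" for x y
  proof -
    have in': "\<Phi> (m\<^sub>X x y) \<in> mspace Y" "m\<^sub>Y (\<Phi> x) (\<Phi> y) \<in> mspace Y"
      using conical_midpoint_mapD(1)[OF m\<^sub>X] conical_midpoint_mapD(1)[OF m\<^sub>Y] \<Phi>_in xy by auto
    have "mdist Y (\<Phi> (m\<^sub>X x y)) (m\<^sub>Y (\<Phi> x) (\<Phi> y)) \<le> 0"
    proof (rule le_if_le_add_mult[where C = "2 * L"])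
      fix e :: real assume e: "e > 0"
      obtain u where u: "u \<in> Vset j" "mdist X (\<iota> u) x < e"
        using completion_dense[OF compl xy(1) e] .
      obtain v where v: "v \<in> Vset j" "mdist X (\<iota> v) y < e"
        using completion_dense[OF compl xy(2) e] .
      have \<iota>: "\<iota> u \<in> mspace X" "\<iota> v \<in> mspace X" using completion_in[OF compl] u v by auto
      let ?w = "mid u v"
      have w: "?w \<in> Vset j" using mid_in_Vset u v by blast
      have "mdist X (\<iota> ?w) (m\<^sub>X x y) \<le> (mdist X (\<iota> u) x + mdist X (\<iota> v) y) / 2"
        using conical_midpoint_map_dist_le[OF m\<^sub>X \<iota> xy] mid u v by simp
      also have "\<dots> \<le> e" using u(2) v(2) by simp
      finally have "mdist X (\<iota> ?w) (m\<^sub>X x y) \<le> e" .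
      then have "L * mdist X (\<iota> ?w) (m\<^sub>X x y) \<le> L * e" using L0 by (rule mult_left_mono)
      then have 1: "mdist Y (?\<phi> ?w) (\<Phi> (m\<^sub>X x y)) \<le> L * e"
        using close[OF w, of "m\<^sub>X x y"] conical_midpoint_mapD(1)[OF m\<^sub>X xy] by linarith
      have "mdist Y (?\<phi> ?w) (m\<^sub>Y (\<Phi> x) (\<Phi> y)) \<le> (mdist Y (?\<phi> u) (\<Phi> x) + mdist Y (?\<phi> v) (\<Phi> y)) / 2"
        using conical_midpoint_map_dist_le[OF m\<^sub>Y \<phi>_in \<phi>_in \<Phi>_in \<Phi>_in, OF xy]
          eval_mid_mid[OF m\<^sub>Y f(1)] by simp
      moreover have "L * mdist X (\<iota> u) x \<le> L * e" "L * mdist X (\<iota> v) y \<le> L * e"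
        using u v L0 by (auto intro: mult_left_mono)
      ultimately have 2: "mdist Y (?\<phi> ?w) (m\<^sub>Y (\<Phi> x) (\<Phi> y)) \<le> L * e"
        using close[OF u(1) xy(1)] close[OF v(1) xy(2)] by (simp add: field_simps)
      show "mdist Y (\<Phi> (m\<^sub>X x y)) (m\<^sub>Y (\<Phi> x) (\<Phi> y)) \<le> 0 + 2 * L * e"
        using mdist_triangle[of "\<Phi> (m\<^sub>X x y)" Y "?\<phi> ?w" "m\<^sub>Y (\<Phi> x) (\<Phi> y)"] in' \<phi>_in 1 2
        by (simp add: mdist_commute)
    qed
    with in' show ?thesis by (rule eqI)
  qed
  have X: "mcomplete_of X" using compl by (simp add: is_metric_completion_def)
  have "bicombing_convex Y (induced_bicombing Y m\<^sub>Y) (\<Phi> ` mspace X)"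
    by (rule bicombing_convex_image[OF X m\<^sub>X assms(4) m\<^sub>Y Lip]) (rule hom)
  moreover have "A \<subseteq> \<Phi> ` mspace X"
  proof
    fix a assume "a \<in> A"
    then obtain i where i: "i < j" "a = f i" using f(2) by blast
    have "Atom i \<in> Vn j 0" using i by simp
    then have "Atom i \<in> Vset j" unfolding Vset_def by blast
    then show "a \<in> \<Phi> ` mspace X" using \<Phi>_\<iota> completion_in[OF compl] i
      by (intro image_eqI[of _ _ "\<iota> (Atom i)"]) auto
  qed
  ultimately show ?thesis using Lip by blast
qed

end
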